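(* Let $(X,X_+,\mathcal K,f)$ be an abstract state space whose cone $X_+$ is $\lambda$-generating, let $P$ be a projection on $X$ with $P\neq I$, and let $T,S\in\Sigma(X)$. Then: (i) $0\le \delta_P(T)\le 1$; (ii) $|\delta_P(T)-\delta_P(S)|\le \delta_P(T-S)\le \|T-S\|$; (iii) if $P\in\Sigma(X)$, then $$\delta_P(T)\le \frac{\lambda}{2}\sup\{\|Tu-Tv\| : u,v\in\mathcal K,\ u-v\in N_P\};$$ (iv) if $H:X\to X$ is a bounded linear operator such that $HP=PH$, then $\delta_P(TH)\le \delta_P(T)\|H\|$; (v) if $H:X\to X$ is a bounded linear operator such that $PH=0$, then $\|TH\|\le \delta_P(T)\|H\|$; (vi) if $S\in\Sigma_P(X)$, then $\delta_P(TS)\le \delta_P(T)\,\delta_P(S)$.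
   Context: Let $X$ be a real ordered vector space with generating cone $X_+$ ($X=X_+-X_+$), let $f$ be a strictly positive linear functional on $X$ ($f(x)>0$ for $x>0$), and let $\mathcal K=\{x\in X_+: f(x)=1\}$. Let $U$ be the convex hull of $\mathcal K\cup(-\mathcal K)$ and $\|x\|=\inf\{t\ge 0: x\in tU\}$. $(X,X_+,\mathcal K,f)$ is an abstract state space if this seminorm is a norm, $X$ is complete for it, and $X_+$ is closed; $X$ always carries this norm. The cone $X_+$ is $\lambda$-generating ($\lambda\ge1$) if every $x\in X$ can be written $x=y-z$ with $y,z\in X_+$ and $\|y\|+\|z\|\le\lambda\|x\|$. A linear operator $T:X\to X$ is Markov if it is positive ($Tx\ge 0$ whenever $x\ge0$) and $T(\mathcal K)\subset\mathcal K$. $\Sigma(X)$ is the set of Markov operators on $X$. A projection is a linear operator $P:X\to X$ with $P^2=P$; $\Sigma_P(X)=\{T\in\Sigma(X): TP=PT\}$. For a projection $P\ne I$ put $N_P=\{x\in X: Px=0\}$, and for a bounded linear operator $T$ on $X$, $$\delta_P(T)=\sup_{x\in N_P,\,x\neq0}\frac{\|Tx\|}{\|x\|}.$$ *)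

theory Defs
  imports "HOL-Analysis.Analysis"
begin

text \<open>
  The vector space, its order and its norm are given by the type \<open>'a\<close>: the cone is
  \<open>{x. 0 \<le> x}\<close>, the class \<open>ordered_real_vector\<close> makes it a proper convex cone, and the
  class \<open>banach\<close> says that the norm of \<open>'a\<close> is a complete norm. The locale
  \<open>abstract_state_space\<close> ties this norm to the order and the functional.
\<close>

definition cone_base :: "('a::ordered_real_vector \<Rightarrow> real) \<Rightarrow> 'a set" where
  "cone_base f = {x. 0 \<le> x \<and> f x = 1}"

definition base_ball :: "('a::ordered_real_vector \<Rightarrow> real) \<Rightarrow> 'a set" where
  "base_ball f = convex hull (cone_base f \<union> uminus ` cone_base f)"

definition base_seminorm :: "('a::ordered_real_vector \<Rightarrow> real) \<Rightarrow> 'a \<Rightarrow> real" where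
  "base_seminorm f x = Inf {t. 0 \<le> t \<and> x \<in> (*\<^sub>R) t ` base_ball f}"

locale abstract_state_space =
  fixes f :: "'a::{ordered_real_vector, banach} \<Rightarrow> real"
  assumes generating: "\<exists>y z. 0 \<le> y \<and> 0 \<le> z \<and> x = y - z"
    and linear_functional: "linear f"
    and strictly_positive: "0 < x \<Longrightarrow> 0 < f x"
    and closed_cone: "closed {x::'a. 0 \<le> x}"
    and norm_eq_base_seminorm: "norm x = base_seminorm f x"

definition lambda_generating :: "'a::{ordered_real_vector, real_normed_vector} itself \<Rightarrow> real \<Rightarrow> bool" where
  "lambda_generating _ l \<longleftrightarrow>
     1 \<le> l \<and> (\<forall>x::'a. \<exists>y z. 0 \<le> y \<and> 0 \<le> z \<and> x = y - z \<and> norm y + norm z \<le> l * norm x)"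

definition Markov :: "('a::ordered_real_vector \<Rightarrow> real) \<Rightarrow> ('a \<Rightarrow> 'a) set" where
  "Markov f = {T. linear T \<and> (\<forall>x\<ge>0. 0 \<le> T x) \<and> T ` cone_base f \<subseteq> cone_base f}"

definition Markov_commuting ::
  "('a::ordered_real_vector \<Rightarrow> real) \<Rightarrow> ('a \<Rightarrow> 'a) \<Rightarrow> ('a \<Rightarrow> 'a) set" where
  "Markov_commuting f P = {T \<in> Markov f. T \<circ> P = P \<circ> T}"

text \<open>Projections are not required to be bounded.\<close>

definition is_projection :: "('a::real_vector \<Rightarrow> 'a) \<Rightarrow> bool" where
  "is_projection P \<longleftrightarrow> linear P \<and> P \<circ> P = P"

definition null_space :: "('a::real_vector \<Rightarrow> 'a) \<Rightarrow> 'a set" where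
  "null_space P = {x. P x = 0}"

text \<open>
  The supremum is taken in \<open>real\<close>. It is meaningful for a projection \<open>P \<noteq> id\<close>, whose null
  space is nonzero, and a bounded linear \<open>T\<close>.
\<close>

definition delta :: "('a::real_normed_vector \<Rightarrow> 'a) \<Rightarrow> ('a \<Rightarrow> 'a) \<Rightarrow> real" where
  "delta P T = (SUP x \<in> null_space P - {0}. norm (T x) / norm x)"

end

theory Submission
  imports Defs
begin

text \<open>
  The unit ball of the norm is, up to its boundary, the set \<open>base_ball f\<close>, and a Markov operator
  maps this set into itself because it is linear and preserves \<open>cone_base f\<close>. Hence Markov
  operators are contractions. Consequently \<open>delta P T\<close> is the operator norm of \<open>T\<close> restricted
  to the null space of \<open>P\<close>, a nonzero subspace as \<open>P \<noteq> id\<close>. It is characterized by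
  two facts, \<open>norm_le_delta\<close> (it is a Lipschitz constant on the null space) and \<open>delta_leI\<close>
  (it is the least one).

  With these, (i), (ii) and (iv)--(vi) are the usual estimates for operator norms. In (iv) and (vi)
  the inner operator commutes with \<open>P\<close> and so preserves the null space, whereas in (v) it takes
  all its values there.

  In (iii) the order enters beyond contractivity. A Markov projection preserves \<open>f\<close>, so \<open>f\<close> vanishes on its null space.
  If \<open>x\<close> lies there and \<open>x = y - z\<close> is a decomposition with
  \<open>norm y + norm z \<le> l * norm x\<close>, then \<open>f y = f z\<close>; this common value \<open>a\<close> satisfies
  \<open>2 * a \<le> l * norm x\<close>, and \<open>x = a *\<^sub>R (u - v)\<close> with \<open>u\<close>, \<open>v\<close> in the base. So the
  difference of two base elements already tests \<open>T\<close> up to the factor \<open>l / 2\<close>.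
\<close>

section \<open>The operator norm on the null space of a projection\<close>

lemma projection_null_space_nontrivial:
  assumes "is_projection P" and "P \<noteq> id"
  obtains x where "x \<in> null_space P" and "x \<noteq> 0"
proof -
  from \<open>P \<noteq> id\<close> obtain x where "P x \<noteq> x"
    by (auto simp: fun_eq_iff)
  moreover have "P (x - P x) = 0"
    using assms(1) by (simp add: is_projection_def linear_diff fun_eq_iff)
  ultimately show thesis
    using that[of "x - P x"] by (auto simp: null_space_def)
qed

lemma norm_le_delta:
  assumes "bounded_linear T" and "x \<in> null_space P"
  shows "norm (T x) \<le> delta P T * norm x"
proof (cases "x = 0")
  case True
  then show ?thesis
    using assms(1) by (simp add: bounded_linear.linear linear_0)
next
  case False
  have "bdd_above ((\<lambda>x. norm (T x) / norm x) ` (null_space P - {0}))"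
    using le_onorm[OF assms(1)] by (auto simp: bdd_above_def)
  then have "norm (T x) / norm x \<le> delta P T"
    unfolding delta_def using assms(2) False by (intro cSUP_upper) auto
  then show ?thesis
    using False by (simp add: divide_simps)
qed

lemma delta_leI:
  assumes "is_projection P" and "P \<noteq> id"
    and "\<And>x. x \<in> null_space P \<Longrightarrow> x \<noteq> 0 \<Longrightarrow> norm (T x) \<le> c * norm x"
  shows "delta P T \<le> c"
  unfolding delta_def
proof (rule cSUP_least)
  show "null_space P - {0} \<noteq> {}"
    using projection_null_space_nontrivial[OF assms(1,2)] by blast
qed (use assms(3) in \<open>auto simp: divide_simps\<close>)

lemma delta_nonneg:
  assumes "is_projection P" and "P \<noteq> id" and "bounded_linear T"
  shows "0 \<le> delta P T"
proof -
  obtain x where x: "x \<in> null_space P" "x \<noteq> 0"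
    using projection_null_space_nontrivial[OF assms(1,2)] .
  have "0 \<le> delta P T * norm x"
    using norm_le_delta[OF assms(3) x(1)] norm_ge_zero[of "T x"] by linarith
  then show ?thesis
    using x(2) by (simp add: zero_le_mult_iff)
qed

lemma delta_le_onorm:
  assumes "is_projection P" and "P \<noteq> id" and "bounded_linear T"
  shows "delta P T \<le> onorm T"
  by (rule delta_leI[OF assms(1,2)]) (rule onorm[OF assms(3)])

lemma delta_triangle:
  assumes "is_projection P" and "P \<noteq> id" and "bounded_linear T" and "bounded_linear S"
  shows "delta P T \<le> delta P S + delta P (\<lambda>x. T x - S x)"
proof (rule delta_leI[OF assms(1,2)])
  fix x assume x: "x \<in> null_space P"
  have "norm (T x) \<le> norm (S x) + norm (T x - S x)"
    by (metis norm_triangle_sub)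
  also have "\<dots> \<le> delta P S * norm x + delta P (\<lambda>x. T x - S x) * norm x"
    using norm_le_delta[OF assms(4) x]
      norm_le_delta[OF bounded_linear_sub[OF assms(3,4)] x] by linarith
  finally show "norm (T x) \<le> (delta P S + delta P (\<lambda>x. T x - S x)) * norm x"
    by (simp add: distrib_right)
qed

lemma abs_delta_diff_le:
  assumes "is_projection P" and "P \<noteq> id" and "bounded_linear T" and "bounded_linear S"
  shows "\<bar>delta P T - delta P S\<bar> \<le> delta P (\<lambda>x. T x - S x)"
proof -
  have "delta P (\<lambda>x. S x - T x) = delta P (\<lambda>x. T x - S x)"
    unfolding delta_def by (simp add: norm_minus_commute)
  then show ?thesis
    using delta_triangle[OF assms] delta_triangle[OF assms(1,2,4,3)] by linarith
qed

lemma null_space_commuting: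
  assumes "linear H" and "H \<circ> P = P \<circ> H" and "x \<in> null_space P"
  shows "H x \<in> null_space P"
  using fun_cong[OF assms(2), of x] assms(1,3) by (simp add: null_space_def linear_0)

lemma delta_comp_le:
  assumes "is_projection P" and "P \<noteq> id" and "bounded_linear T" and "bounded_linear H"
    and "H \<circ> P = P \<circ> H"
  shows "delta P (T \<circ> H) \<le> delta P T * delta P H"
proof (rule delta_leI[OF assms(1,2)])
  fix x assume x: "x \<in> null_space P"
  have "norm (T (H x)) \<le> delta P T * norm (H x)"
    using null_space_commuting[OF bounded_linear.linear[OF assms(4)] assms(5) x]
    by (rule norm_le_delta[OF assms(3)])
  also have "\<dots> \<le> delta P T * (delta P H * norm x)"
    by (intro mult_left_mono norm_le_delta delta_nonneg assms x)
  finally show "norm ((T \<circ> H) x) \<le> delta P T * delta P H * norm x"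
    by (simp add: mult.assoc)
qed

lemma delta_comp_le_onorm:
  assumes "is_projection P" and "P \<noteq> id" and "bounded_linear T" and "bounded_linear H"
    and "H \<circ> P = P \<circ> H"
  shows "delta P (T \<circ> H) \<le> delta P T * onorm H"
  using delta_comp_le[OF assms] delta_nonneg[OF assms(1-3)] delta_le_onorm[OF assms(1,2,4)]
  by (meson mult_left_mono order_trans)

lemma onorm_comp_le_delta:
  assumes "is_projection P" and "P \<noteq> id" and "bounded_linear T" and "bounded_linear H"
    and "P \<circ> H = (\<lambda>x. 0)"
  shows "onorm (T \<circ> H) \<le> delta P T * onorm H"
proof (rule onorm_bound)
  show "0 \<le> delta P T * onorm H"
    by (intro mult_nonneg_nonneg delta_nonneg onorm_pos_le assms)
  fix x
  have "H x \<in> null_space P"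
    using fun_cong[OF assms(5), of x] by (simp add: null_space_def)
  then have "norm (T (H x)) \<le> delta P T * norm (H x)"
    by (rule norm_le_delta[OF assms(3)])
  also have "\<dots> \<le> delta P T * (onorm H * norm x)"
    by (intro mult_left_mono onorm delta_nonneg assms)
  finally show "norm ((T \<circ> H) x) \<le> delta P T * onorm H * norm x"
    by (simp add: mult.assoc)
qed

section \<open>The base norm and Markov operators\<close>

context abstract_state_space
begin

lemma positive_eq_scaled_base:
  assumes "0 \<le> y" and "y \<noteq> 0"
  obtains k where "k \<in> cone_base f" and "y = f y *\<^sub>R k" and "0 < f y"
proof
  show pos: "0 < f y"
    using assms strictly_positive[of y] by simp
  show "inverse (f y) *\<^sub>R y \<in> cone_base f"
    using pos assms by (simp add: cone_base_def scaleR_nonneg_nonneg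
        linear_scale[OF linear_functional])
  show "y = f y *\<^sub>R inverse (f y) *\<^sub>R y"
    using pos by simp
qed

text \<open>
  The infimum defining the norm is not over the empty set: normalizing the two parts of
  \<open>x = y - z\<close> exhibits \<open>x\<close> as a multiple of a convex combination of a base element
  and the negative of another one.
\<close>

lemma eq_scaled_base_ball:
  assumes "x \<noteq> 0"
  obtains t u where "0 \<le> t" and "u \<in> base_ball f" and "x = t *\<^sub>R u"
proof -
  obtain y z where yz: "0 \<le> y" "0 \<le> z" "x = y - z"
    using generating by blast
  obtain k0 where k0: "k0 \<in> cone_base f"
    using positive_eq_scaled_base yz assms by (metis diff_self)
  \<comment> \<open>A vanishing part of \<open>x\<close> is the zero multiple of \<open>k0\<close>.\<close>
  have scaled: "\<exists>k\<in>cone_base f. w = f w *\<^sub>R k \<and> 0 \<le> f w" if "0 \<le> w" for w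
  proof (cases "w = 0")
    case True
    then show ?thesis
      using k0 linear_0[OF linear_functional] by auto
  next
    case False
    then show ?thesis
      using positive_eq_scaled_base[OF that] by (metis less_imp_le)
  qed
  obtain k m where k: "k \<in> cone_base f" "y = f y *\<^sub>R k" "0 \<le> f y"
    and m: "m \<in> cone_base f" "z = f z *\<^sub>R m" "0 \<le> f z"
    using scaled[OF yz(1)] scaled[OF yz(2)] by blast
  define t where "t = f y + f z"
  have "t \<noteq> 0"
  proof
    assume "t = 0"
    then have "f y = 0" "f z = 0"
      using k(3) m(3) by (auto simp: t_def)
    then show False
      using k(2) m(2) yz(3) assms by simp
  qed
  then have t: "0 < t"
    using k(3) m(3) by (simp add: t_def)
  have "(f y / t) *\<^sub>R k + (f z / t) *\<^sub>R (- m) \<in> base_ball f"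
    unfolding base_ball_def
  proof (rule convexD[OF convex_convex_hull])
    show "f y / t + f z / t = 1"
      using t by (simp add: t_def flip: add_divide_distrib)
  qed (use k m t in \<open>auto intro: hull_inc\<close>)
  moreover have "x = t *\<^sub>R ((f y / t) *\<^sub>R k + (f z / t) *\<^sub>R (- m))"
    using t k(2) m(2) yz(3) by (simp add: scaleR_right_diff_distrib)
  ultimately show thesis
    using that[OF less_imp_le[OF t]] by blast
qed

lemma norm_scaled_base_ball_le:
  assumes "u \<in> base_ball f" and "0 \<le> t"
  shows "norm (t *\<^sub>R u) \<le> t"
  unfolding norm_eq_base_seminorm base_seminorm_def
  using assms by (intro cInf_lower) (auto simp: bdd_below_def)

lemma norm_lessE:
  assumes "norm x < s" and "x \<noteq> 0"
  obtains t u where "0 \<le> t" and "t < s" and "u \<in> base_ball f" and "x = t *\<^sub>R u"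
proof -
  let ?A = "{t. 0 \<le> t \<and> x \<in> (*\<^sub>R) t ` base_ball f}"
  have "?A \<noteq> {}"
    using eq_scaled_base_ball[OF assms(2)] by blast
  moreover have "Inf ?A < s"
    using assms(1) by (simp add: norm_eq_base_seminorm base_seminorm_def)
  ultimately obtain t where "t \<in> ?A" "t < s"
    using cInf_lessD[of ?A s] by blast
  then show thesis
    using that by auto
qed

lemma norm_cone_base_le:
  assumes "u \<in> cone_base f"
  shows "norm u \<le> 1"
proof -
  have "u \<in> base_ball f"
    unfolding base_ball_def using assms by (simp add: hull_inc)
  then show ?thesis
    using norm_scaled_base_ball_le[of u 1] by simp
qed

text \<open>
  The half-space where \<open>f \<le> 1\<close> is convex and contains the base and its negative, hence also
  \<open>base_ball f\<close>.
\<close>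

lemma functional_le_norm: "f x \<le> norm x"
proof (cases "x = 0")
  case True
  then show ?thesis
    by (simp add: linear_0[OF linear_functional])
next
  case False
  have "convex {x. f x \<le> 1}"
    using convex_linear_vimage[OF linear_functional, of "{..1}"] by (simp add: vimage_def)
  moreover have "cone_base f \<union> uminus ` cone_base f \<subseteq> {x. f x \<le> 1}"
    by (auto simp: cone_base_def linear_neg[OF linear_functional])
  ultimately have ball: "base_ball f \<subseteq> {x. f x \<le> 1}"
    unfolding base_ball_def by (rule hull_minimal[rotated])
  show ?thesis
  proof (rule field_le_epsilon)
    fix e :: real assume "0 < e"
    then obtain t u where t: "0 \<le> t" "t < norm x + e" "u \<in> base_ball f" "x = t *\<^sub>R u"
      using norm_lessE[of x "norm x + e"] False by auto
    have "f x = t * f u"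
      using t(4) by (simp add: linear_scale[OF linear_functional])
    also have "\<dots> \<le> t"
      using ball t(1,3) by (intro mult_left_le) auto
    finally show "f x \<le> norm x + e"
      using t(2) by simp
  qed
qed

lemma Markov_base_ball:
  assumes "T \<in> Markov f" and "u \<in> base_ball f"
  shows "T u \<in> base_ball f"
proof -
  have T: "linear T" "T ` cone_base f \<subseteq> cone_base f"
    using assms(1) by (auto simp: Markov_def)
  have "T u \<in> convex hull (T ` (cone_base f \<union> uminus ` cone_base f))"
    using assms(2) unfolding base_ball_def convex_hull_linear_image[OF T(1), symmetric]
    by (rule imageI)
  also have "\<dots> \<subseteq> base_ball f"
    unfolding base_ball_def using T by (intro hull_mono) (auto simp: linear_neg)
  finally show ?thesis .
qed

lemma Markov_contraction:
  assumes "T \<in> Markov f"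
  shows "norm (T x) \<le> norm x"
proof (cases "x = 0")
  case True
  then show ?thesis
    using assms by (simp add: Markov_def linear_0)
next
  case False
  show ?thesis
  proof (rule field_le_epsilon)
    fix e :: real assume "0 < e"
    then obtain t u where t: "0 \<le> t" "t < norm x + e" "u \<in> base_ball f" "x = t *\<^sub>R u"
      using norm_lessE[of x "norm x + e"] False by auto
    have "T x = t *\<^sub>R T u"
      using assms t(4) by (simp add: Markov_def linear_scale)
    then have "norm (T x) \<le> t"
      using norm_scaled_base_ball_le[OF Markov_base_ball[OF assms t(3)] t(1)] by simp
    then show "norm (T x) \<le> norm x + e"
      using t(2) by simp
  qed
qed

lemma Markov_bounded_linear:
  assumes "T \<in> Markov f"
  shows "bounded_linear T"
  using assms Markov_contraction[OF assms]
  by (intro bounded_linear_intro[where K = 1]) (auto simp: Markov_def linear_add linear_scale)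

text \<open>
  On the cone this is the invariance of the base, rescaled; it extends to the whole space because
  the cone generates it.
\<close>

lemma Markov_preserves_functional:
  assumes "T \<in> Markov f"
  shows "f (T x) = f x"
proof -
  have T: "linear T" "T ` cone_base f \<subseteq> cone_base f"
    using assms by (auto simp: Markov_def)
  have pos: "f (T y) = f y" if "0 \<le> y" for y
  proof (cases "y = 0")
    case True
    then show ?thesis by (simp add: linear_0[OF T(1)])
  next
    case False
    obtain k where k: "k \<in> cone_base f" "y = f y *\<^sub>R k"
      using positive_eq_scaled_base[OF \<open>0 \<le> y\<close> False] by blast
    have "f (T y) = f (T (f y *\<^sub>R k))"
      using k(2) by simp
    also have "\<dots> = f y * f (T k)"
      by (simp add: linear_scale[OF T(1)] linear_scale[OF linear_functional])
    also have "f (T k) = 1"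
      using T(2) k(1) by (auto simp: cone_base_def)
    finally show ?thesis by simp
  qed
  obtain y z where "0 \<le> y" "0 \<le> z" "x = y - z"
    using generating by blast
  then show ?thesis
    by (simp add: linear_diff[OF T(1)] linear_diff[OF linear_functional] pos)
qed

section \<open>Testing on differences of base elements\<close>

text \<open>
  The constant \<open>l / 2\<close> arises because both parts of a vector annihilated by \<open>f\<close> have the same mass,
  so each carries half of the budget \<open>l * norm x\<close>.
\<close>

lemma annihilated_eq_scaled_base_diff:
  assumes "lambda_generating TYPE('a) l" and "f x = 0" and "x \<noteq> 0"
  obtains a u v where "0 < a" and "a \<le> l / 2 * norm x"
    and "u \<in> cone_base f" and "v \<in> cone_base f" and "x = a *\<^sub>R (u - v)"
proof -
  obtain y z where yz: "0 \<le> y" "0 \<le> z" "x = y - z" "norm y + norm z \<le> l * norm x"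
    using assms(1) unfolding lambda_generating_def by blast
  have eq: "f y = f z"
    using assms(2) yz(3) by (simp add: linear_diff[OF linear_functional])
  have "y \<noteq> 0" "z \<noteq> 0"
    using eq assms(3) yz(1-3) strictly_positive[of y] strictly_positive[of z]
      linear_0[OF linear_functional] by (force simp: order_less_le)+
  then obtain u v where u: "u \<in> cone_base f" "y = f y *\<^sub>R u" "0 < f y"
    and v: "v \<in> cone_base f" "z = f z *\<^sub>R v"
    using positive_eq_scaled_base[OF yz(1)] positive_eq_scaled_base[OF yz(2)] by metis
  have "x = f y *\<^sub>R (u - v)"
    using u(2) v(2) eq yz(3) by (simp add: scaleR_right_diff_distrib)
  moreover have "f y \<le> l / 2 * norm x"
    using functional_le_norm[of y] functional_le_norm[of z] eq yz(4) by simp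
  ultimately show thesis
    using that u v by blast
qed

lemma delta_le_base_diff:
  assumes "lambda_generating TYPE('a) l" and "is_projection P" and "P \<noteq> id"
    and "T \<in> Markov f" and "P \<in> Markov f"
  shows "delta P T \<le> l / 2 *
    (SUP (u, v) \<in> {(u, v). u \<in> cone_base f \<and> v \<in> cone_base f \<and> u - v \<in> null_space P}.
       norm (T u - T v))"
    (is "_ \<le> l / 2 * (SUP (u, v) \<in> ?D. _)")
proof (rule delta_leI[OF assms(2,3)])
  let ?g = "\<lambda>(u, v). norm (T u - T v)"
  have lin: "linear T" "linear P"
    using assms(4,5) by (auto simp: Markov_def)
  have bdd: "bdd_above (?g ` ?D)"
  proof (rule bdd_aboveI2)
    fix p assume "p \<in> ?D"
    then obtain u v where p: "p = (u, v)" "u \<in> cone_base f" "v \<in> cone_base f"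
      by blast
    have "norm (T u - T v) \<le> norm (T u) + norm (T v)"
      by (rule norm_triangle_ineq4)
    also have "\<dots> \<le> 2"
      using Markov_contraction[OF assms(4), of u] Markov_contraction[OF assms(4), of v]
        norm_cone_base_le[OF p(2)] norm_cone_base_le[OF p(3)] by linarith
    finally show "?g p \<le> 2" by (simp add: p(1))
  qed
  fix x assume x: "x \<in> null_space P" "x \<noteq> 0"
  have "f x = 0"
    using Markov_preserves_functional[OF assms(5), of x] x(1)
    by (simp add: null_space_def linear_0[OF linear_functional])
  then obtain a u v where a: "0 < a" "a \<le> l / 2 * norm x"
    and uv: "u \<in> cone_base f" "v \<in> cone_base f" and x_eq: "x = a *\<^sub>R (u - v)"
    using annihilated_eq_scaled_base_diff[OF assms(1) _ x(2)] by blast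
  have "u - v \<in> null_space P"
    using x(1) a(1) by (simp add: x_eq null_space_def linear_scale[OF lin(2)])
  then have sup: "norm (T u - T v) \<le> (SUP p \<in> ?D. ?g p)"
    using cSUP_upper[OF _ bdd, of "(u, v)"] uv by simp
  have "norm (T x) = a * norm (T u - T v)"
    using a(1) by (simp add: x_eq linear_scale[OF lin(1)] linear_diff[OF lin(1)])
  also have "\<dots> \<le> a * (SUP p \<in> ?D. ?g p)"
    using sup a(1) by simp
  also have "\<dots> \<le> l / 2 * norm x * (SUP p \<in> ?D. ?g p)"
    using order_trans[OF norm_ge_zero sup] by (rule mult_right_mono[OF a(2)])
  finally show "norm (T x) \<le> l / 2 * (SUP p \<in> ?D. ?g p) * norm x"
    by (simp add: ac_simps)
qed

end

section \<open>Properties of the ergodicity coefficient\<close>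

theorem theorem3p7:
  fixes f :: "'a::{ordered_real_vector, banach} \<Rightarrow> real"
    and l :: real
    and P T S :: "'a \<Rightarrow> 'a"
  assumes "abstract_state_space f"
    and "lambda_generating TYPE('a) l"
    and "is_projection P" and "P \<noteq> id"
    and "T \<in> Markov f" and "S \<in> Markov f"
  shows "(0 \<le> delta P T \<and> delta P T \<le> 1)
    \<and> (\<bar>delta P T - delta P S\<bar> \<le> delta P (\<lambda>x. T x - S x)
        \<and> delta P (\<lambda>x. T x - S x) \<le> onorm (\<lambda>x. T x - S x))
    \<and> (P \<in> Markov f \<longrightarrow>
        delta P T \<le> l / 2 *
          (SUP (u, v) \<in> {(u, v). u \<in> cone_base f \<and> v \<in> cone_base f \<and> u - v \<in> null_space P}.
             norm (T u - T v)))
    \<and> (\<forall>H::'a \<Rightarrow> 'a. bounded_linear H \<and> H \<circ> P = P \<circ> H \<longrightarrow> delta P (T \<circ> H) \<le> delta P T * onorm H)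
    \<and> (\<forall>H::'a \<Rightarrow> 'a. bounded_linear H \<and> P \<circ> H = (\<lambda>x. 0) \<longrightarrow> onorm (T \<circ> H) \<le> delta P T * onorm H)
    \<and> (S \<in> Markov_commuting f P \<longrightarrow> delta P (T \<circ> S) \<le> delta P T * delta P S)"
proof -
  interpret abstract_state_space f by fact
  note P = assms(3,4)
  have T: "bounded_linear T" and S: "bounded_linear S"
    using Markov_bounded_linear assms(5,6) by blast+
  have "delta P T \<le> 1"
    using Markov_contraction[OF assms(5)] by (intro delta_leI[OF P]) simp
  moreover have "delta P (T \<circ> S) \<le> delta P T * delta P S" if "S \<in> Markov_commuting f P"
    using that by (intro delta_comp_le[OF P T S]) (simp add: Markov_commuting_def)
  ultimately show ?thesis
    using delta_nonneg[OF P T] abs_delta_diff_le[OF P T S]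
      delta_le_onorm[OF P bounded_linear_sub[OF T S]]
      delta_le_base_diff[OF assms(2) P assms(5)]
      delta_comp_le_onorm[OF P T] onorm_comp_le_delta[OF P T]
    by (intro conjI allI impI) auto
qed

end
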